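(* Let $\kappa$ be a nonzero real number, let $\tilde E_\kappa(2)$, its subalgebra $E_\kappa(2)$ and the right ideal $\tilde R_0\subset\tilde E_\kappa(2)$ be as in the context. Then the right ideal $R_0=E_\kappa(2)\cap\tilde R_0$ of $E_\kappa(2)$ is generated by the following elements: $$(A-I)(A^*-I);$$ $$(A-I)v_--\tfrac{i}{\kappa}(A^*-I);\qquad (A^*-I)v_-+\tfrac{i}{\kappa}(A^*-I);$$ $$(A-I)v_++\tfrac{i}{\kappa}(A-I);\qquad (A^*-I)v_+-\tfrac{i}{\kappa}(A-I);$$ $$v_-v_++\tfrac{i}{2\kappa}(v_++3v_-)+\tfrac{1}{4\kappa^2}(A^*-A);$$ $$v_+^2+\tfrac{i}{2\kappa}(3v_++v_-)+\tfrac{1}{4\kappa^2}(A^*-A);\qquad v_-^2+\tfrac{i}{2\kappa}(v_++3v_-)+\tfrac{1}{4\kappa^2}(A^*-A).$$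
   Context: $[x,y]=xy-yx$ and $I$ is the unit. $\tilde E_\kappa(2)$ (the deformed double covering of $E(2)$) is the unital complex $*$-algebra generated by $a_0,a_0^*,w_0,w_0^*$ with relations $a_0a_0^*=a_0^*a_0=I$, $[a_0,w_0]=-[a_0,w_0^*]=\frac1{2\kappa}(a_0^2-I)$, $[a_0^*,w_0]=-[a_0^*,w_0^*]=\frac1{2\kappa}((a_0^* )^2-I)$, $[w_0,w_0^*]=-\frac1{2\kappa}(a_0+a_0^* )(w_0+w_0^* )$. $E_\kappa(2)$ is the subalgebra of $\tilde E_\kappa(2)$ generated by $$A=a_0^2,\qquad A^*=(a_0^* )^2,\qquad v_+=-ia_0w_0,\qquad v_-=iw_0^*a_0^*.$$ These satisfy $AA^*=A^*A=I$, $[A,v_-]=\frac i\kappa(I-A)$, $[A^*,v_-]=\frac i\kappa(A^*-(A^* )^2)$, $[A,v_+]=\frac i\kappa(A-A^2)$, $[A^*,v_+]=\frac i\kappa(I-A^* )$, $[v_+,v_-]=\frac i\kappa(v_--v_+)$. $\tilde R_0$ is the right ideal of $\tilde E_\kappa(2)$ (the contraction of the ideal defining Woronowicz's 3D left-covariant calculus on $SU_\mu(2)$) generated by $(a_0-I)(a_0^*-I)$; $(a_0-I)w_0^*+\frac{1}{2\kappa}(a_0-a_0^* )$; $(a_0-I)w_0-\frac{1}{2\kappa}(a_0-a_0^* )$; $(a_0^*-I)w_0^*-\frac{1}{2\kappa}(a_0-a_0^* )$; $(a_0^*-I)w_0+\frac{1}{2\kappa}(a_0-a_0^* )$; $w_0^*w_0+\frac{1}{2\kappa}(w_0-3w_0^*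 )-\frac{1}{4\kappa^2}(a_0-a_0^* )$; $w_0^2+\frac{1}{2\kappa}(w_0^*-3w_0)+\frac{1}{4\kappa^2}(a_0-a_0^* )$; $(w_0^* )^2-\frac{1}{2\kappa}(w_0-3w_0^* )+\frac{1}{4\kappa^2}(a_0-a_0^* )$. *)

theory Defs
  imports
    Complex_Main
    "HOL-Library.Poly_Mapping"
    "HOL-Algebra.Generated_Rings"
    "HOL-Algebra.Algebraic_Closure_Type"
begin

section \<open>The free unital complex *-algebra on $a_0$ and $w_0$\<close>

datatype gen = A0 | A0s | W0 | W0s

text \<open>Words form the free monoid. It is written additively (and is not commutative), since the
  convolution product of \<^type>\<open>poly_mapping\<close> requires keys of class \<^class>\<open>monoid_add\<close>.\<close>

datatype 'a word = Word (letters: "'a list")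

instantiation word :: (type) monoid_add
begin

definition zero_word :: "'a word" where
  "zero_word = Word []"

definition plus_word :: "'a word \<Rightarrow> 'a word \<Rightarrow> 'a word" where
  "plus_word u v = Word (letters u @ letters v)"

instance
  by standard (simp_all add: zero_word_def plus_word_def)

end

type_synonym free_alg = "gen word \<Rightarrow>\<^sub>0 complex"

definition scal :: "complex \<Rightarrow> free_alg" where
  "scal c = Poly_Mapping.single 0 c"

definition gen_el :: "gen \<Rightarrow> free_alg" where
  "gen_el x = Poly_Mapping.single (Word [x]) 1"

abbreviation a0 :: free_alg where "a0 \<equiv> gen_el A0"
abbreviation a0s :: free_alg where "a0s \<equiv> gen_el A0s"
abbreviation w0 :: free_alg where "w0 \<equiv> gen_el W0"
abbreviation w0s :: free_alg where "w0s \<equiv> gen_el W0s"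

definition commutator :: "free_alg \<Rightarrow> free_alg \<Rightarrow> free_alg" where
  "commutator x y = x * y - y * x"

fun gen_star :: "gen \<Rightarrow> gen" where
  "gen_star A0 = A0s"
| "gen_star A0s = A0"
| "gen_star W0 = W0s"
| "gen_star W0s = W0"

definition word_star :: "gen word \<Rightarrow> gen word" where
  "word_star u = Word (rev (map gen_star (letters u)))"

text \<open>The antilinear anti-multiplicative involution.\<close>

definition star :: "free_alg \<Rightarrow> free_alg" where
  "star p = (\<Sum>u\<in>Poly_Mapping.keys p. Poly_Mapping.single (word_star u) (cnj (Poly_Mapping.lookup p u)))"

abbreviation Free :: "free_alg ring" where
  "Free \<equiv> ring_of_type_algebra"


section \<open>The deformed double covering of $E(2)$\<close>

definition relators :: "real \<Rightarrow> free_alg set" where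
  "relators \<kappa> =
    {a0 * a0s - 1,
     a0s * a0 - 1,
     commutator a0 w0 - scal (1 / (2 * \<kappa>)) * (a0\<^sup>2 - 1),
     commutator a0 w0s + scal (1 / (2 * \<kappa>)) * (a0\<^sup>2 - 1),
     commutator a0s w0 - scal (1 / (2 * \<kappa>)) * (a0s\<^sup>2 - 1),
     commutator a0s w0s + scal (1 / (2 * \<kappa>)) * (a0s\<^sup>2 - 1),
     commutator w0 w0s + scal (1 / (2 * \<kappa>)) * ((a0 + a0s) * (w0 + w0s))}"

text \<open>Presentation as a *-algebra: the two-sided ideal is also generated by the adjoints of the
  relators. Ideals of the ring are automatically closed under scalars, because \<^term>\<open>scal c\<close>
  belongs to the algebra.\<close>

definition rel_ideal :: "real \<Rightarrow> free_alg set" where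
  "rel_ideal \<kappa> = Idl\<^bsub>Free\<^esub> (relators \<kappa> \<union> star ` relators \<kappa>)"

definition E_tilde :: "real \<Rightarrow> free_alg set ring" where
  "E_tilde \<kappa> = Free Quot rel_ideal \<kappa>"

definition cls :: "real \<Rightarrow> free_alg \<Rightarrow> free_alg set" where
  "cls \<kappa> p = rel_ideal \<kappa> +>\<^bsub>Free\<^esub> p"

definition star_E :: "free_alg set \<Rightarrow> free_alg set" where
  "star_E C = star ` C"


section \<open>The subalgebra $E_\kappa(2)$\<close>

text \<open>Representatives in the free algebra of $A$, $A^*$, $v_+$, $v_-$.\<close>

definition A_el :: free_alg where "A_el = a0\<^sup>2"
definition As_el :: free_alg where "As_el = a0s\<^sup>2"
definition vp :: free_alg where "vp = - scal \<i> * a0 * w0"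
definition vm :: free_alg where "vm = scal \<i> * w0s * a0s"

text \<open>A unital complex subalgebra is a subring that contains the classes of all scalars.\<close>

definition E_carrier :: "real \<Rightarrow> free_alg set set" where
  "E_carrier \<kappa> = generate_ring (E_tilde \<kappa>) (cls \<kappa> ` (range scal \<union> {A_el, As_el, vp, vm}))"

definition E_alg :: "real \<Rightarrow> free_alg set ring" where
  "E_alg \<kappa> = (E_tilde \<kappa>)\<lparr>carrier := E_carrier \<kappa>\<rparr>"


section \<open>Right ideals\<close>

locale right_ideal = additive_subgroup I R + ring R for I and R (structure) +
  assumes I_r_closed: "\<lbrakk>a \<in> I; x \<in> carrier R\<rbrakk> \<Longrightarrow> a \<otimes> x \<in> I"

definition gen_right_ideal :: "('a, 'b) ring_scheme \<Rightarrow> 'a set \<Rightarrow> 'a set" where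
  "gen_right_ideal R S = \<Inter>{I. right_ideal I R \<and> S \<subseteq> I}"

definition R0_tilde :: "real \<Rightarrow> free_alg set set" where
  "R0_tilde \<kappa> = gen_right_ideal (E_tilde \<kappa>) (cls \<kappa> `
    {(a0 - 1) * (a0s - 1),
     (a0 - 1) * w0s + scal (1 / (2 * \<kappa>)) * (a0 - a0s),
     (a0 - 1) * w0 - scal (1 / (2 * \<kappa>)) * (a0 - a0s),
     (a0s - 1) * w0s - scal (1 / (2 * \<kappa>)) * (a0 - a0s),
     (a0s - 1) * w0 + scal (1 / (2 * \<kappa>)) * (a0 - a0s),
     w0s * w0 + scal (1 / (2 * \<kappa>)) * (w0 - 3 * w0s) - scal (1 / (4 * \<kappa>\<^sup>2)) * (a0 - a0s),
     w0\<^sup>2 + scal (1 / (2 * \<kappa>)) * (w0s - 3 * w0) + scal (1 / (4 * \<kappa>\<^sup>2)) * (a0 - a0s),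
     w0s\<^sup>2 - scal (1 / (2 * \<kappa>)) * (w0 - 3 * w0s) + scal (1 / (4 * \<kappa>\<^sup>2)) * (a0 - a0s)})"


section \<open>Well-definedness of the structures\<close>

lemma word_star_word_star [simp]: "word_star (word_star u) = u"
proof -
  have "gen_star (gen_star x) = x" for x by (cases x) auto
  then have "gen_star \<circ> gen_star = id" by auto
  then show ?thesis by (cases u) (simp add: word_star_def rev_map)
qed

lemma word_star_plus: "word_star (u + v) = word_star v + word_star u"
  by (simp add: word_star_def plus_word_def)

lemma word_star_zero [simp]: "word_star 0 = 0"
  by (simp add: word_star_def zero_word_def)

lemma lookup_star: "Poly_Mapping.lookup (star p) u = cnj (Poly_Mapping.lookup p (word_star u))"
proof -
  have *: "word_star v = u \<longleftrightarrow> v = word_star u" for v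
    by (metis word_star_word_star)
  have "Poly_Mapping.lookup (star p) u =
      (\<Sum>v\<in>Poly_Mapping.keys p. if v = word_star u then cnj (Poly_Mapping.lookup p v) else 0)"
    unfolding star_def lookup_sum lookup_single when_def * ..
  also have "\<dots> = cnj (Poly_Mapping.lookup p (word_star u))"
    by (simp add: in_keys_iff)
  finally show ?thesis .
qed

lemma star_star [simp]: "star (star p) = p"
  by (rule poly_mapping_eqI) (simp add: lookup_star)

lemma star_add: "star (p + q) = star p + star q"
  by (rule poly_mapping_eqI) (simp add: lookup_star lookup_add)

lemma star_uminus: "star (- p) = - star p"
  by (rule poly_mapping_eqI) (simp add: lookup_star)

lemma star_zero [simp]: "star 0 = 0"
  by (rule poly_mapping_eqI) (simp add: lookup_star)

lemma star_single: "star (Poly_Mapping.single u c) = Poly_Mapping.single (word_star u) (cnj c)"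
  by (cases "c = 0") (simp_all add: star_def)

lemma star_scal: "star (scal c) = scal (cnj c)"
  by (simp add: scal_def star_single)

lemma star_gen_el [simp]: "star (gen_el x) = gen_el (gen_star x)"
  by (simp add: gen_el_def star_single word_star_def)

lemma star_sum: "star (sum f S) = (\<Sum>x\<in>S. star (f x))"
  by (induction S rule: infinite_finite_induct) (simp_all add: star_add)

lemma poly_mapping_sum_single: "(\<Sum>u\<in>Poly_Mapping.keys p. Poly_Mapping.single u (Poly_Mapping.lookup p u)) = p"
  by (rule poly_mapping_eqI)
     (auto simp: lookup_sum lookup_single when_def in_keys_iff intro: sum.neutral)

lemma star_mult: "star (p * q) = star q * star p"
proof -
  have "star (p * q) =
      star ((\<Sum>u\<in>Poly_Mapping.keys p. Poly_Mapping.single u (Poly_Mapping.lookup p u)) *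
            (\<Sum>v\<in>Poly_Mapping.keys q. Poly_Mapping.single v (Poly_Mapping.lookup q v)))"
    by (simp only: poly_mapping_sum_single)
  also have "\<dots> = (\<Sum>u\<in>Poly_Mapping.keys p. \<Sum>v\<in>Poly_Mapping.keys q.
      star (Poly_Mapping.single v (Poly_Mapping.lookup q v)) * star (Poly_Mapping.single u (Poly_Mapping.lookup p u)))"
    by (simp add: sum_product star_sum mult_single star_single word_star_plus mult.commute)
  also have "\<dots> = (\<Sum>v\<in>Poly_Mapping.keys q. star (Poly_Mapping.single v (Poly_Mapping.lookup q v))) *
      (\<Sum>u\<in>Poly_Mapping.keys p. star (Poly_Mapping.single u (Poly_Mapping.lookup p u)))"
    unfolding sum_product by (rule sum.swap)
  also have "\<dots> = star q * star p"
    by (simp only: star_sum [symmetric] poly_mapping_sum_single)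
  finally show ?thesis .
qed

lemma star_A: "star A_el = As_el"
  by (simp add: A_el_def As_el_def power2_eq_square star_mult)

lemma scal_mult_commute: "scal c * p = p * scal c"
proof -
  have "scal c * (\<Sum>u\<in>Poly_Mapping.keys p. Poly_Mapping.single u (Poly_Mapping.lookup p u)) =
      (\<Sum>u\<in>Poly_Mapping.keys p. Poly_Mapping.single u (Poly_Mapping.lookup p u)) * scal c"
    by (simp add: scal_def sum_distrib_left sum_distrib_right mult_single mult.commute)
  then show ?thesis by (simp only: poly_mapping_sum_single)
qed

lemma star_vp: "star vp = vm"
proof -
  have "scal (- \<i>) = - scal \<i>"
    by (simp add: scal_def single_uminus)
  then have "star vp = w0s * (a0s * scal \<i>)"
    by (simp add: vp_def star_mult star_uminus star_scal)
  also have "\<dots> = vm"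
    by (metis vm_def scal_mult_commute mult.assoc)
  finally show ?thesis .
qed

lemma Free_simps [simp]:
  "carrier Free = UNIV" "monoid.mult Free = (*)" "ring.add Free = (+)" "monoid.one Free = 1" "ring.zero Free = 0"
  by (simp_all add: ring_of_type_algebra_def)

lemma ring_Free: "ring Free"
proof -
  have "\<exists>y. x + y = 0" for x :: free_alg
    using add.right_inverse by blast
  then show ?thesis
    unfolding ring_of_type_algebra_def using add.right_inverse
    by unfold_locales (auto simp: algebra_simps Units_def)
qed

lemma ideal_rel_ideal: "ideal (rel_ideal \<kappa>) Free"
  unfolding rel_ideal_def by (rule ring.genideal_ideal[OF ring_Free]) simp

lemma ring_E_tilde: "ring (E_tilde \<kappa>)"
  unfolding E_tilde_def by (rule ideal.quotient_is_ring[OF ideal_rel_ideal])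

lemma cls_hom: "cls \<kappa> \<in> ring_hom Free (E_tilde \<kappa>)"
  unfolding cls_def E_tilde_def
  using ideal.rcos_ring_hom[OF ideal_rel_ideal] by (simp add: eta_contract_eq)

lemma E_gens_in_carrier: "cls \<kappa> ` S \<subseteq> carrier (E_tilde \<kappa>)"
  using cls_hom[of \<kappa>] by (auto simp: ring_hom_def)

lemma ring_E: "ring (E_alg \<kappa>)"
  unfolding E_alg_def E_carrier_def
  by (rule ring.generate_ring_is_ring[OF ring_E_tilde E_gens_in_carrier])

lemma a_inv_Free: "\<ominus>\<^bsub>Free\<^esub> p = - p"
proof -
  interpret ring Free by (rule ring_Free)
  show ?thesis by (rule minus_equality) simp_all
qed

lemma star_rel_ideal: "star ` rel_ideal \<kappa> = rel_ideal \<kappa>"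
proof -
  interpret F: ring Free by (rule ring_Free)
  interpret J: ideal "rel_ideal \<kappa>" Free by (rule ideal_rel_ideal)
  have add: "p + q \<in> rel_ideal \<kappa>" if "p \<in> rel_ideal \<kappa>" "q \<in> rel_ideal \<kappa>" for p q
    using J.a_closed[OF that] by simp
  have uminus: "- p \<in> rel_ideal \<kappa>" if "p \<in> rel_ideal \<kappa>" for p
    using J.a_inv_closed[OF that] by (simp add: a_inv_Free)
  have mult: "p * q \<in> rel_ideal \<kappa>" "q * p \<in> rel_ideal \<kappa>" if "p \<in> rel_ideal \<kappa>" for p q
    using J.I_r_closed[OF that, of q] J.I_l_closed[OF that, of q] by simp_all
  have zero: "0 \<in> rel_ideal \<kappa>"
    using J.zero_closed by simp
  have mem: "p \<in> star ` rel_ideal \<kappa> \<longleftrightarrow> star p \<in> rel_ideal \<kappa>" for p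
    by (metis image_iff star_star)
  have "ideal (star ` rel_ideal \<kappa>) Free"
  proof (rule idealI[OF ring_Free])
    show "subgroup (star ` rel_ideal \<kappa>) (add_monoid Free)"
    proof (rule F.add.subgroupI)
      show "star ` rel_ideal \<kappa> \<noteq> {}" using zero by blast
    next
      fix p assume "p \<in> star ` rel_ideal \<kappa>"
      then show "\<ominus>\<^bsub>Free\<^esub> p \<in> star ` rel_ideal \<kappa>"
        by (simp add: mem star_uminus uminus a_inv_Free)
    next
      fix p q assume "p \<in> star ` rel_ideal \<kappa>" "q \<in> star ` rel_ideal \<kappa>"
      then show "p \<oplus>\<^bsub>Free\<^esub> q \<in> star ` rel_ideal \<kappa>"
        by (simp add: mem star_add add)
    qed simp
  qed (simp_all add: mem star_mult mult)
  moreover have "relators \<kappa> \<union> star ` relators \<kappa> \<subseteq> rel_ideal \<kappa>"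
    unfolding rel_ideal_def by (rule F.genideal_self) simp
  then have "relators \<kappa> \<union> star ` relators \<kappa> \<subseteq> star ` rel_ideal \<kappa>"
    by (auto simp: mem)
  ultimately have *: "rel_ideal \<kappa> \<subseteq> star ` rel_ideal \<kappa>"
    by (subst rel_ideal_def) (rule F.genideal_minimal)
  have "star ` rel_ideal \<kappa> \<subseteq> rel_ideal \<kappa>"
    using image_mono[OF *, of star] by (simp add: image_image)
  with * show ?thesis by blast
qed

lemma star_E_cls: "star_E (cls \<kappa> p) = cls \<kappa> (star p)"
proof -
  have cls: "cls \<kappa> q = (\<lambda>r. r + q) ` rel_ideal \<kappa>" for q
    by (auto simp: cls_def a_r_coset_def r_coset_def)
  have "star_E (cls \<kappa> p) = (\<lambda>r. r + star p) ` star ` rel_ideal \<kappa>"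
    by (simp add: star_E_def cls image_image star_add)
  then show ?thesis by (simp add: star_rel_ideal cls)
qed

end

theory Submission
  imports Defs "HOL-Library.Product_Plus"
begin

text \<open>The quotient of the large algebra by the right ideal \<open>R\<^sub>0\<close> tilde is a right module of dimension
  four, spanned by the classes of \<open>1, a\<^sub>0 - 1, w\<^sub>0, w\<^sub>0\<^sup>*\<close>. Writing down the action of the generators
  on this basis gives an explicit module (\<open>act\<close>), on which the defining relations vanish
  (\<open>act_rel_ideal\<close>), and \<open>R\<^sub>0\<close> tilde turns out to be the annihilator of the cyclic vector
  \<open>(1, 0, 0, 0)\<close> (\<open>R0_tilde_iff\<close>).

  The claimed generators of the intersection annihilate the cyclic vector (\<open>act_gens_E\<close>), and so
  the right ideal \<open>Q\<close> that they generate in the subalgebra is contained in \<open>R\<^sub>0\<close> tilde. Conversely,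
  modulo \<open>Q\<close> the generators \<open>A, A\<^sup>*, v\<^sub>+, v\<^sub>-\<close> map the span of \<open>1, A - 1, v\<^sub>+, v\<^sub>-\<close> to itself under
  right multiplication (\<open>reduction_E.reduces_gens\<close>). Therefore each element of the subalgebra is
  congruent modulo \<open>Q\<close> to a combination of these four elements. Since they send the cyclic vector
  to linearly independent vectors, the combination can be read off from the action on the cyclic
  vector. An element of the intersection annihilates that vector, hence it is congruent to zero,
  which means that it lies in \<open>Q\<close>.

  The same reduction argument, with \<open>1, a\<^sub>0 - 1, w\<^sub>0, w\<^sub>0\<^sup>*\<close> in place of \<open>1, A - 1, v\<^sub>+, v\<^sub>-\<close>, shows
  that the annihilator of the cyclic vector is contained in \<open>R\<^sub>0\<close> tilde. It is therefore carried out
  once, in the locale \<open>reduction\<close>. No normal form theorem for the algebra itself is needed: the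
  independence of the four classes is witnessed by the module.\<close>

section \<open>A four-dimensional right module\<close>

text \<open>Row vectors \<open>(x, y, z, u)\<close>, the coordinates with respect to the basis
  \<open>1, a\<^sub>0 - 1, w\<^sub>0, w\<^sub>0\<^sup>*\<close> of the quotient of the algebra by the right ideal
  \<open>R\<^sub>0\<close> tilde.\<close>
type_synonym vec = "complex \<times> complex \<times> complex \<times> complex"

text \<open>Multiplication of a vector by a complex number.\<close>
fun scl :: "complex \<Rightarrow> vec \<Rightarrow> vec" where
  "scl c (x, y, z, u) = (c * x, c * y, c * z, c * u)"

text \<open>Right multiplication of the basis by the generators, found by reducing the products
  \<open>1 g\<close>, \<open>(a\<^sub>0 - 1) g\<close>, \<open>w\<^sub>0 g\<close>, \<open>w\<^sub>0\<^sup>* g\<close> modulo the generators of the right ideal. The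
  parameter \<open>h\<close> stands for \<open>1 / (2 \<kappa>)\<close>.\<close>
fun act_gen :: "complex \<Rightarrow> gen \<Rightarrow> vec \<Rightarrow> vec" where
  "act_gen h A0 (x, y, z, u) = (x, x + y, z, u)"
| "act_gen h A0s (x, y, z, u) = (x, y - x, z, u)"
| "act_gen h W0 (x, y, z, u) =
     (0, 2 * h * y - 2 * h\<^sup>2 * z + 2 * h\<^sup>2 * u, x + 3 * h * z - h * u, 3 * h * u - h * z)"
| "act_gen h W0s (x, y, z, u) =
     (0, - 2 * h * y + 2 * h\<^sup>2 * z - 2 * h\<^sup>2 * u, h * u - 3 * h * z, x + h * z - 3 * h * u)"

text \<open>This is a right action, so the leftmost letter of a word acts first.\<close>
definition act_word :: "complex \<Rightarrow> gen word \<Rightarrow> vec \<Rightarrow> vec" where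
  "act_word h w = fold (act_gen h) (letters w)"

text \<open>Extension of the action to the free algebra by linearity.\<close>
definition act :: "complex \<Rightarrow> free_alg \<Rightarrow> vec \<Rightarrow> vec" where
  "act h p v = (\<Sum>w\<in>Poly_Mapping.keys p. scl (Poly_Mapping.lookup p w) (act_word h w v))"

lemma scl_simps:
  "scl c (v + w) = scl c v + scl c w" "scl (c + d) v = scl c v + scl d v"
  "scl c (scl d v) = scl (c * d) v" "scl 1 v = v" "scl 0 v = 0" "scl c 0 = 0"
  by (cases v; cases w; simp add: algebra_simps zero_prod_def)+

lemma scl_sum: "scl c (sum f S) = (\<Sum>x\<in>S. scl c (f x))"
  by (induction S rule: infinite_finite_induct) (simp_all add: scl_simps)

lemma act_gen_linear:
  "act_gen h g (v + w) = act_gen h g v + act_gen h g w"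
  "act_gen h g (scl c v) = scl c (act_gen h g v)"
  by (cases g; cases v; cases w; simp add: algebra_simps)+

lemma act_word_linear:
  "act_word h w (u + v) = act_word h w u + act_word h w v"
  "act_word h w (scl c u) = scl c (act_word h w u)"
proof -
  have "fold (act_gen h) l (u + v) = fold (act_gen h) l u + fold (act_gen h) l v"
    "fold (act_gen h) l (scl c u) = scl c (fold (act_gen h) l u)" for l
    by (induction l arbitrary: u v) (simp_all add: act_gen_linear)
  then show "act_word h w (u + v) = act_word h w u + act_word h w v"
    "act_word h w (scl c u) = scl c (act_word h w u)"
    by (simp_all add: act_word_def)
qed

lemma act_word_sum: "act_word h w (sum f S) = (\<Sum>x\<in>S. act_word h w (f x))"
proof (induction S rule: infinite_finite_induct)
  case empty
  \<comment> \<open>The zero vector is \<open>scl 0 0\<close>, so it is preserved by linearity.\<close>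
  have "act_word h w (scl 0 0) = scl 0 (act_word h w 0)" by (rule act_word_linear)
  then show ?case by (simp add: scl_simps)
next
  case (infinite S)
  have "act_word h w (scl 0 0) = scl 0 (act_word h w 0)" by (rule act_word_linear)
  with infinite show ?case by (simp add: scl_simps)
qed (simp_all add: act_word_linear)

lemma act_word_plus: "act_word h (w + w') v = act_word h w' (act_word h w v)"
  by (simp add: act_word_def plus_word_def)

lemma act_superset:
  assumes "finite S" "Poly_Mapping.keys p \<subseteq> S"
  shows "act h p v = (\<Sum>w\<in>S. scl (Poly_Mapping.lookup p w) (act_word h w v))"
  unfolding act_def using assms
  by (intro sum.mono_neutral_left) (auto simp: in_keys_iff scl_simps)

lemma act_add: "act h (p + q) v = act h p v + act h q v"
proof -
  let ?S = "Poly_Mapping.keys p \<union> Poly_Mapping.keys q"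
  have "finite ?S" "Poly_Mapping.keys (p + q) \<subseteq> ?S"
    by (auto dest: subsetD[OF keys_add])
  then show ?thesis
    by (simp add: act_superset[of ?S] lookup_add scl_simps sum.distrib)
qed

lemma act_single: "act h (Poly_Mapping.single w c) v = scl c (act_word h w v)"
  by (simp add: act_def scl_simps)

lemma act_zero [simp]: "act h 0 v = 0"
  by (simp add: act_def)

lemma act_sum: "act h (sum f S) v = (\<Sum>x\<in>S. act h (f x) v)"
  by (induction S rule: infinite_finite_induct) (simp_all add: act_add)

lemma act_uminus: "act h (- p) v = - act h p v"
  using act_add[of h p "- p" v] by (simp add: eq_neg_iff_add_eq_0 add.commute)

lemma act_diff: "act h (p - q) v = act h p v - act h q v"
  using act_add[of h p "- q" v] by (simp add: act_uminus)

lemma act_mult: "act h (p * q) v = act h q (act h p v)"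
proof -
  let ?p = "Poly_Mapping.lookup p" and ?q = "Poly_Mapping.lookup q"
  have "act h (p * q) v =
      act h ((\<Sum>u\<in>Poly_Mapping.keys p. Poly_Mapping.single u (?p u)) *
             (\<Sum>w\<in>Poly_Mapping.keys q. Poly_Mapping.single w (?q w))) v"
    by (simp only: poly_mapping_sum_single)
  also have "\<dots> = (\<Sum>u\<in>Poly_Mapping.keys p. \<Sum>w\<in>Poly_Mapping.keys q.
      scl (?p u * ?q w) (act_word h w (act_word h u v)))"
    by (simp add: sum_product act_sum mult_single act_single act_word_plus)
  also have "\<dots> = (\<Sum>w\<in>Poly_Mapping.keys q. \<Sum>u\<in>Poly_Mapping.keys p.
      scl (?p u * ?q w) (act_word h w (act_word h u v)))"
    by (rule sum.swap)
  also have "\<dots> = act h q (act h p v)"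
    by (simp add: act_def act_word_sum act_word_linear scl_sum scl_simps mult.commute)
  finally show ?thesis .
qed

lemma act_scal: "act h (scal c) v = scl c v"
  by (simp add: scal_def act_single act_word_def zero_word_def)

lemma act_gen_el: "act h (gen_el g) v = act_gen h g v"
  by (simp add: gen_el_def act_single act_word_def scl_simps)

lemma scal_simps:
  "scal 1 = 1" "scal 0 = 0" "scal (numeral n) = numeral n"
  "scal (- c) = - scal c" "scal (c + d) = scal c + scal d" "scal (c - d) = scal c - scal d"
  "scal (c * d) = scal c * scal d"
  by (simp_all add: scal_def single_uminus single_add single_diff mult_single)

lemma act_one: "act h 1 v = v"
  using act_scal[of h 1 v] by (simp add: scal_simps scl_simps)

lemma act_numeral: "act h (numeral n) v = scl (numeral n) v"
  using act_scal[of h "numeral n" v] by (simp add: scal_simps)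

lemmas act_simps = act_add act_diff act_uminus act_mult act_scal act_gen_el act_one act_numeral

lemma act_linear:
  "act h p (v + w) = act h p v + act h p w"
  "act h p (scl c v) = scl c (act h p v)"
proof -
  show "act h p (v + w) = act h p v + act h p w"
    by (simp add: act_def act_word_linear scl_simps sum.distrib)
  have "act h p (scl c v) = act h (scal c * p) v" by (simp add: act_mult act_scal)
  also have "\<dots> = scl c (act h p v)" by (simp add: scal_mult_commute act_mult act_scal)
  finally show "act h p (scl c v) = scl c (act h p v)" .
qed

lemma act_0_right: "act h p 0 = 0"
  using act_linear(2)[of h p 0 0] by (simp add: scl_simps)

text \<open>The constant \<open>1 / (2 \<kappa>)\<close>, in which all coefficients of the relations are polynomial.\<close>
definition half_inv :: "real \<Rightarrow> complex" where "half_inv \<kappa> = complex_of_real (1 / (2 * \<kappa>))"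

lemma coeffs_half_inv: "complex_of_real (1 / (2 * \<kappa>)) = half_inv \<kappa>"
  "complex_of_real (1 / (4 * \<kappa>\<^sup>2)) = half_inv \<kappa> * half_inv \<kappa>"
  "\<i> / complex_of_real (2 * \<kappa>) = \<i> * half_inv \<kappa>"
  by (simp_all add: half_inv_def power2_eq_square)

lemma i_over_eq_half_inv: "\<i> / complex_of_real \<kappa> = \<i> * (2 * half_inv \<kappa>)"
  by (simp add: half_inv_def)

lemma star_one: "star 1 = 1"
  using star_scal[of 1] by (simp add: scal_simps)

lemma star_diff: "star (p - q) = star p - star q"
  using star_add[of p "- q"] by (simp add: star_uminus)

lemma cnj_half_inv: "cnj (half_inv \<kappa>) = half_inv \<kappa>"
  by (simp add: half_inv_def)

lemma relators_half_inv: "relators \<kappa> =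
    {a0 * a0s - 1,
     a0s * a0 - 1,
     commutator a0 w0 - scal (half_inv \<kappa>) * (a0 * a0 - 1),
     commutator a0 w0s + scal (half_inv \<kappa>) * (a0 * a0 - 1),
     commutator a0s w0 - scal (half_inv \<kappa>) * (a0s * a0s - 1),
     commutator a0s w0s + scal (half_inv \<kappa>) * (a0s * a0s - 1),
     commutator w0 w0s + scal (half_inv \<kappa>) * ((a0 + a0s) * (w0 + w0s))}"
  by (simp only: relators_def coeffs_half_inv power2_eq_square)

lemma act_relators:
  assumes "p \<in> relators \<kappa> \<union> star ` relators \<kappa>"
  shows "act (half_inv \<kappa>) p v = 0"
proof -
  obtain x y z u where v: "v = (x, y, z, u)" by (cases v)
  have "\<forall>p\<in>relators \<kappa>. act (half_inv \<kappa>) p v = 0 \<and> act (half_inv \<kappa>) (star p) v = 0"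
    unfolding relators_half_inv v ball_simps
    by (simp_all add: act_simps commutator_def star_add star_diff star_uminus star_mult star_scal
          star_one cnj_half_inv zero_prod_def, simp_all add: algebra_simps power2_eq_square)
  with assms show ?thesis by blast
qed

text \<open>The defining relations act by zero, so the action descends to the quotient algebra.\<close>
lemma act_rel_ideal:
  assumes "p \<in> rel_ideal \<kappa>"
  shows "act (half_inv \<kappa>) p v = 0"
proof -
  interpret F: ring Free by (rule ring_Free)
  define N where "N = {p. act (half_inv \<kappa>) p = (\<lambda>v. 0)}"
  have N: "p \<in> N \<longleftrightarrow> (\<forall>v. act (half_inv \<kappa>) p v = 0)" for p
    by (auto simp: N_def)
  have "ideal N Free"
  proof (rule idealI[OF ring_Free])
    show "subgroup N (add_monoid Free)"
      by (rule F.add.subgroupI)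
        (auto simp: N a_inv_Free act_simps simp del: split_paired_All dest: equals0D[of N 0])
  qed (auto simp: N act_mult act_0_right simp del: split_paired_All)
  moreover have "relators \<kappa> \<union> star ` relators \<kappa> \<subseteq> N"
    using act_relators by (auto simp: N simp del: split_paired_All)
  ultimately have "rel_ideal \<kappa> \<subseteq> N"
    unfolding rel_ideal_def by (rule F.genideal_minimal)
  with assms N show ?thesis by blast
qed

section \<open>Consequences of the defining relations\<close>

lemma scal_left: "x * scal c = scal c * x" "x * (scal c * y) = scal c * (x * y)"
  by (metis scal_mult_commute mult.assoc)+

lemma scal_i_square: "scal \<i> * scal \<i> = - 1" "scal \<i> * (scal \<i> * x) = - x"
proof -
  show "scal \<i> * scal \<i> = - 1"
    by (simp flip: scal_simps(7) add: scal_simps)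
  then show "scal \<i> * (scal \<i> * x) = - x"
    by (simp flip: mult.assoc)
qed

lemma numeral_expand: "2 * x = x + x" "3 * x = x + x + x" "4 * x = x + x + x + x"
  "x * 2 = x + x" "x * 3 = x + x + x" "x * 4 = x + x + x + x" for x :: free_alg
proof -
  have *: "(3::free_alg) = 1 + 1 + 1" "(4::free_alg) = 1 + 1 + 1 + 1" by simp_all
  show "2 * x = x + x" "3 * x = x + x + x" "4 * x = x + x + x + x"
    "x * 2 = x + x" "x * 3 = x + x + x" "x * 4 = x + x + x + x"
    by (simp_all only: mult_2 mult_2_right * distrib_right distrib_left mult_1_left mult_1_right)
qed

text \<open>Rewriting to sums of monomials with the scalars in front. Numerals become repeated sums, so
  that equal elements of the free algebra get the same normal form. Identities which express an
  element through relators or through generators of a right ideal are verified in this way.\<close>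
lemmas free_norm = scal_simps numeral_expand
  scal_left[of "scal _"] scal_left[of "gen_el _"]
  scal_i_square algebra_simps

lemma rel_closed:
  "0 \<in> rel_ideal \<kappa>"
  "p \<in> rel_ideal \<kappa> \<Longrightarrow> q \<in> rel_ideal \<kappa> \<Longrightarrow> p + q \<in> rel_ideal \<kappa>"
  "p \<in> rel_ideal \<kappa> \<Longrightarrow> - p \<in> rel_ideal \<kappa>"
  "p \<in> rel_ideal \<kappa> \<Longrightarrow> q \<in> rel_ideal \<kappa> \<Longrightarrow> p - q \<in> rel_ideal \<kappa>"
  "p \<in> rel_ideal \<kappa> \<Longrightarrow> p * q \<in> rel_ideal \<kappa>"
  "p \<in> rel_ideal \<kappa> \<Longrightarrow> q * p \<in> rel_ideal \<kappa>"
proof -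
  interpret F: ring Free by (rule ring_Free)
  interpret J: ideal "rel_ideal \<kappa>" Free by (rule ideal_rel_ideal)
  show "0 \<in> rel_ideal \<kappa>"
    using J.zero_closed by simp
  show add: "p + q \<in> rel_ideal \<kappa>" if "p \<in> rel_ideal \<kappa>" "q \<in> rel_ideal \<kappa>" for p q
    using J.a_closed[OF that] by simp
  show uminus: "- p \<in> rel_ideal \<kappa>" if "p \<in> rel_ideal \<kappa>" for p
    using J.a_inv_closed[OF that] by (simp add: a_inv_Free)
  show "p - q \<in> rel_ideal \<kappa>" if "p \<in> rel_ideal \<kappa>" "q \<in> rel_ideal \<kappa>"
    using add[OF that(1) uminus[OF that(2)]] by simp
  show "p * q \<in> rel_ideal \<kappa>" "q * p \<in> rel_ideal \<kappa>" if "p \<in> rel_ideal \<kappa>"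
    using J.I_r_closed[OF that, of q] J.I_l_closed[OF that, of q] by simp_all
qed

lemma relators_in_rel_ideal:
  "a0 * a0s - 1 \<in> rel_ideal \<kappa>"
  "a0s * a0 - 1 \<in> rel_ideal \<kappa>"
  "a0 * w0 - w0 * a0 - scal (half_inv \<kappa>) * (a0 * a0 - 1) \<in> rel_ideal \<kappa>"
  "a0 * w0s - w0s * a0 + scal (half_inv \<kappa>) * (a0 * a0 - 1) \<in> rel_ideal \<kappa>"
  "w0 * w0s - w0s * w0 + scal (half_inv \<kappa>) * ((a0 + a0s) * (w0 + w0s)) \<in> rel_ideal \<kappa>"
proof -
  have "relators \<kappa> \<subseteq> rel_ideal \<kappa>"
    unfolding rel_ideal_def using ring.genideal_self[OF ring_Free] by force
  then show
    "a0 * a0s - 1 \<in> rel_ideal \<kappa>"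
    "a0s * a0 - 1 \<in> rel_ideal \<kappa>"
    "a0 * w0 - w0 * a0 - scal (half_inv \<kappa>) * (a0 * a0 - 1) \<in> rel_ideal \<kappa>"
    "a0 * w0s - w0s * a0 + scal (half_inv \<kappa>) * (a0 * a0 - 1) \<in> rel_ideal \<kappa>"
    "w0 * w0s - w0s * w0 + scal (half_inv \<kappa>) * ((a0 + a0s) * (w0 + w0s)) \<in> rel_ideal \<kappa>"
    by (simp_all add: relators_half_inv commutator_def)
qed

text \<open>The relations between \<open>A\<close>, \<open>A\<^sup>*\<close>, \<open>v\<^sub>+\<close> and \<open>v\<^sub>-\<close> that are needed to reduce all products
  of two of them. Each one is displayed as a two-sided combination of the relators \<open>r1\<close> to \<open>r5\<close>.\<close>
lemma E_relations:
  "A_el * As_el - 1 \<in> rel_ideal \<kappa>"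
  "As_el * A_el - 1 \<in> rel_ideal \<kappa>"
  "A_el * vp - vp * A_el - scal \<i> * (2 * scal (half_inv \<kappa>)) * (A_el - A_el * A_el) \<in> rel_ideal \<kappa>"
  "A_el * vm - vm * A_el - scal \<i> * (2 * scal (half_inv \<kappa>)) * (1 - A_el) \<in> rel_ideal \<kappa>"
  "vp * vm - vm * vp - scal \<i> * (2 * scal (half_inv \<kappa>)) * (vm - vp) \<in> rel_ideal \<kappa>"
proof -
  \<comment> \<open>As an opaque central element, \<open>H\<close> is moved to the front of every monomial.\<close>
  define H where "H = scal (half_inv \<kappa>)"
  have H: "x * H = H * x" "x * (H * y) = H * (x * y)" for x y
    unfolding H_def by (rule scal_left)+
  define r1 where "r1 = a0 * a0s - 1"
  define r2 where "r2 = a0s * a0 - 1"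
  define r3 where "r3 = a0 * w0 - w0 * a0 - H * (a0 * a0 - 1)"
  define r4 where "r4 = a0 * w0s - w0s * a0 + H * (a0 * a0 - 1)"
  define r5 where "r5 = w0 * w0s - w0s * w0 + H * ((a0 + a0s) * (w0 + w0s))"
  note r_defs = r1_def r2_def r3_def r4_def r5_def A_el_def As_el_def vp_def vm_def power2_eq_square
  have r: "r1 \<in> rel_ideal \<kappa>" "r2 \<in> rel_ideal \<kappa>" "r3 \<in> rel_ideal \<kappa>"
    "r4 \<in> rel_ideal \<kappa>" "r5 \<in> rel_ideal \<kappa>"
    unfolding r1_def r2_def r3_def r4_def r5_def H_def by (rule relators_in_rel_ideal)+
  note norm = free_norm H[of "gen_el _"] H[of "scal _"]
  have "A_el * As_el - 1 = a0 * r1 * a0s + r1"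
    unfolding r_defs by (simp add: norm)
  moreover have "As_el * A_el - 1 = a0s * r2 * a0 + r2"
    unfolding r_defs by (simp add: norm)
  moreover have "A_el * vp - vp * A_el - scal \<i> * (2 * H) * (A_el - A_el * A_el) =
      - scal \<i> * (a0 * (a0 * r3 + r3 * a0))"
    unfolding r_defs by (simp add: norm)
  moreover have "A_el * vm - vm * A_el - scal \<i> * (2 * H) * (1 - A_el) =
      scal \<i> * (a0 * r4 * a0s + a0 * w0s * r1 - w0s * r2 * a0 + r4 - H * (a0 * a0 - 1) * r1)"
    unfolding r_defs by (simp add: norm)
  \<comment> \<open>Obtained by moving \<open>a\<^sub>0\<close> to the right in \<open>v\<^sub>+ v\<^sub>- = a\<^sub>0 w\<^sub>0 w\<^sub>0\<^sup>* a\<^sub>0\<^sup>*\<close>, after the exchange of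
    \<open>w\<^sub>0\<close> and \<open>w\<^sub>0\<^sup>*\<close>, until it meets \<open>a\<^sub>0\<^sup>*\<close>.\<close>
  moreover have "vp * vm - vm * vp - scal \<i> * (2 * H) * (vm - vp) =
      a0 * r5 * a0s - H * (r1 * ((w0 + w0s) * a0s)) + r4 * (w0 * a0s)
      + w0s * (r3 * a0s + w0 * r1 + H * (a0 * r1)) - w0s * r2 * w0
      - H * (2 * (a0 * r3 * a0s + a0 * w0 * r1 + H * (a0 * a0 * r1) - H * r1)
             + (a0 * r4 * a0s + a0 * w0s * r1 + r4 - H * (a0 * a0 - 1) * r1))"
    unfolding r_defs by (simp add: norm)
  ultimately show
    "A_el * As_el - 1 \<in> rel_ideal \<kappa>"
    "As_el * A_el - 1 \<in> rel_ideal \<kappa>"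
    "A_el * vp - vp * A_el - scal \<i> * (2 * scal (half_inv \<kappa>)) * (A_el - A_el * A_el) \<in> rel_ideal \<kappa>"
    "A_el * vm - vm * A_el - scal \<i> * (2 * scal (half_inv \<kappa>)) * (1 - A_el) \<in> rel_ideal \<kappa>"
    "vp * vm - vm * vp - scal \<i> * (2 * scal (half_inv \<kappa>)) * (vm - vp) \<in> rel_ideal \<kappa>"
    unfolding H_def[symmetric] by (simp_all only: rel_closed r)
qed

section \<open>Reduction to normal form modulo a right ideal\<close>

text \<open>The sets \<open>K\<close> and \<open>B\<close> stand for the preimages in the free algebra of a right ideal and of the
  subalgebra in which it is a right ideal. The map \<open>nf\<close> lifts vectors linearly to the free algebra, and sends the cyclic
  vector to \<open>1\<close>.\<close>
locale reduction =
  fixes \<kappa> :: real and K B :: "free_alg set" and nf :: "vec \<Rightarrow> free_alg"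
  assumes K_zero: "0 \<in> K"
    and K_add: "p \<in> K \<Longrightarrow> q \<in> K \<Longrightarrow> p + q \<in> K"
    and K_uminus: "p \<in> K \<Longrightarrow> - p \<in> K"
    and K_mult: "p \<in> K \<Longrightarrow> q \<in> B \<Longrightarrow> p * q \<in> K"
    and scal_B: "scal c \<in> B"
    and rel_K: "p \<in> rel_ideal \<kappa> \<Longrightarrow> p \<in> K"
    and nf_add: "nf (v + w) = nf v + nf w"
    and nf_scl: "nf (scl c v) = scal c * nf v"
    and nf_e0: "nf (1, 0, 0, 0) = 1"
begin

text \<open>Right multiplication by \<open>p\<close> preserves normal forms modulo \<open>K\<close>, and acts on them as
  prescribed by the module.\<close>
definition reduces :: "free_alg \<Rightarrow> bool" where
  "reduces p \<longleftrightarrow> (\<forall>v. nf v * p - nf (act (half_inv \<kappa>) p v) \<in> K)"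

lemma reducesD: "reduces p \<Longrightarrow> nf v * p - nf (act (half_inv \<kappa>) p v) \<in> K"
  by (simp add: reduces_def del: split_paired_All)

lemma reducesI: "(\<And>v. nf v * p - nf (act (half_inv \<kappa>) p v) \<in> K) \<Longrightarrow> reduces p"
  by (simp add: reduces_def del: split_paired_All)

lemma K_diff: "p \<in> K \<Longrightarrow> q \<in> K \<Longrightarrow> p - q \<in> K"
  using K_add[of p "- q"] K_uminus[of q] by simp

lemma K_scal: "p \<in> K \<Longrightarrow> scal c * p \<in> K"
  using K_mult[OF _ scal_B, of p c] by (simp add: scal_mult_commute)

lemma nf_uminus: "nf (- v) = - nf v"
proof -
  have "- v = scl (- 1) v" by (cases v) simp
  then show ?thesis by (simp add: nf_scl scal_simps)
qed

lemma nf_zero: "nf 0 = 0"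
  using nf_scl[of 0 0] by (simp add: scl_simps scal_simps)

lemma reduces_scal: "reduces (scal c)"
  by (rule reducesI) (simp add: act_scal nf_scl scal_mult_commute K_zero)

lemma reduces_one: "reduces 1"
  using reduces_scal[of 1] by (simp add: scal_simps)

lemma reduces_add:
  assumes "reduces p" "reduces q"
  shows "reduces (p + q)"
proof (rule reducesI)
  fix v
  show "nf v * (p + q) - nf (act (half_inv \<kappa>) (p + q) v) \<in> K"
    using K_add[OF reducesD[OF assms(1), of v] reducesD[OF assms(2), of v]]
    by (simp add: act_add nf_add algebra_simps)
qed

lemma reduces_uminus:
  assumes "reduces p"
  shows "reduces (- p)"
proof (rule reducesI)
  fix v
  show "nf v * (- p) - nf (act (half_inv \<kappa>) (- p) v) \<in> K"
    using K_uminus[OF reducesD[OF assms, of v]] by (simp add: act_uminus nf_uminus)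
qed

lemma reduces_mult:
  assumes "reduces p" "reduces q" "q \<in> B"
  shows "reduces (p * q)"
proof (rule reducesI)
  fix v
  have "(nf v * p - nf (act (half_inv \<kappa>) p v)) * q
      + (nf (act (half_inv \<kappa>) p v) * q - nf (act (half_inv \<kappa>) q (act (half_inv \<kappa>) p v))) \<in> K"
    by (intro K_add K_mult reducesD assms)
  then show "nf v * (p * q) - nf (act (half_inv \<kappa>) (p * q) v) \<in> K"
    by (simp add: act_mult algebra_simps)
qed

text \<open>Products of normal forms with \<open>a\<^sub>0\<^sup>*\<close> and \<open>A\<^sup>*\<close> are reduced by this lemma, without computation.\<close>
lemma reduces_inverse:
  assumes "reduces p" "q \<in> B" "p * q - 1 \<in> rel_ideal \<kappa>" "q * p - 1 \<in> rel_ideal \<kappa>"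
  shows "reduces q"
proof (rule reducesI)
  fix v
  define w where "w = act (half_inv \<kappa>) q v"
  have "act (half_inv \<kappa>) p w = v"
    using act_rel_ideal[OF assms(4), of v] by (simp add: w_def act_simps)
  then have "nf w * p - nf v \<in> K"
    using reducesD[OF assms(1), of w] by simp
  then have "nf w * (p * q - 1) - (nf w * p - nf v) * q \<in> K"
    by (rule K_diff[OF rel_K[OF rel_closed(6)[OF assms(3)]] K_mult[OF _ assms(2)]])
  then show "nf v * q - nf (act (half_inv \<kappa>) q v) \<in> K"
    by (simp add: w_def algebra_simps)
qed

lemma reduces_spanI:
  assumes span: "\<And>v. \<exists>c1 c2 c3 c4. v = scl c1 e1 + scl c2 e2 + scl c3 e3 + scl c4 e4"
    and e: "nf e1 * p - nf (act (half_inv \<kappa>) p e1) \<in> K" "nf e2 * p - nf (act (half_inv \<kappa>) p e2) \<in> K"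
      "nf e3 * p - nf (act (half_inv \<kappa>) p e3) \<in> K" "nf e4 * p - nf (act (half_inv \<kappa>) p e4) \<in> K"
  shows "reduces p"
proof (rule reducesI)
  fix v
  obtain c1 c2 c3 c4 where v: "v = scl c1 e1 + scl c2 e2 + scl c3 e3 + scl c4 e4"
    using span by blast
  have "scal c1 * (nf e1 * p - nf (act (half_inv \<kappa>) p e1)) + scal c2 * (nf e2 * p - nf (act (half_inv \<kappa>) p e2))
      + scal c3 * (nf e3 * p - nf (act (half_inv \<kappa>) p e3)) + scal c4 * (nf e4 * p - nf (act (half_inv \<kappa>) p e4)) \<in> K"
    by (intro K_add K_scal e)
  then show "nf v * p - nf (act (half_inv \<kappa>) p v) \<in> K"
    by (simp add: v act_linear nf_add nf_scl algebra_simps)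
qed

text \<open>As \<open>nf\<close> sends the cyclic vector to \<open>1\<close> and the zero vector to \<open>0\<close>, the reduction of \<open>1 p\<close>
  exhibits \<open>p\<close> as an element of \<open>K\<close>.\<close>
lemma reduces_memI:
  assumes "reduces p" "act (half_inv \<kappa>) p (1, 0, 0, 0) = 0"
  shows "p \<in> K"
  using reducesD[OF assms(1), of "(1, 0, 0, 0)"] by (simp add: nf_e0 assms(2) nf_zero)

end

section \<open>The generators of the two right ideals\<close>

text \<open>The generators of \<open>R\<^sub>0\<close> tilde.\<close>
definition gens_tilde :: "real \<Rightarrow> free_alg set" where
  "gens_tilde \<kappa> =
    {(a0 - 1) * (a0s - 1),
     (a0 - 1) * w0s + scal (half_inv \<kappa>) * (a0 - a0s),
     (a0 - 1) * w0 - scal (half_inv \<kappa>) * (a0 - a0s),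
     (a0s - 1) * w0s - scal (half_inv \<kappa>) * (a0 - a0s),
     (a0s - 1) * w0 + scal (half_inv \<kappa>) * (a0 - a0s),
     w0s * w0 + scal (half_inv \<kappa>) * (w0 - 3 * w0s) - scal (half_inv \<kappa> * half_inv \<kappa>) * (a0 - a0s),
     w0\<^sup>2 + scal (half_inv \<kappa>) * (w0s - 3 * w0) + scal (half_inv \<kappa> * half_inv \<kappa>) * (a0 - a0s),
     w0s\<^sup>2 - scal (half_inv \<kappa>) * (w0 - 3 * w0s) + scal (half_inv \<kappa> * half_inv \<kappa>) * (a0 - a0s)}"

lemma R0_tilde_eq_gens: "R0_tilde \<kappa> = gen_right_ideal (E_tilde \<kappa>) (cls \<kappa> ` gens_tilde \<kappa>)"
  by (simp only: R0_tilde_def gens_tilde_def coeffs_half_inv)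

text \<open>The claimed generators of the intersection with the subalgebra.\<close>
definition gens_E :: "real \<Rightarrow> free_alg set" where
  "gens_E \<kappa> =
    {(A_el - 1) * (As_el - 1),
     (A_el - 1) * vm - scal (\<i> * (2 * half_inv \<kappa>)) * (As_el - 1),
     (As_el - 1) * vm + scal (\<i> * (2 * half_inv \<kappa>)) * (As_el - 1),
     (A_el - 1) * vp + scal (\<i> * (2 * half_inv \<kappa>)) * (A_el - 1),
     (As_el - 1) * vp - scal (\<i> * (2 * half_inv \<kappa>)) * (A_el - 1),
     vm * vp + scal (\<i> * half_inv \<kappa>) * (vp + 3 * vm) + scal (half_inv \<kappa> * half_inv \<kappa>) * (As_el - A_el),
     vp\<^sup>2 + scal (\<i> * half_inv \<kappa>) * (3 * vp + vm) + scal (half_inv \<kappa> * half_inv \<kappa>) * (As_el - A_el),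
     vm\<^sup>2 + scal (\<i> * half_inv \<kappa>) * (vp + 3 * vm) + scal (half_inv \<kappa> * half_inv \<kappa>) * (As_el - A_el)}"

lemma act_gens_tilde: "p \<in> gens_tilde \<kappa> \<Longrightarrow> act (half_inv \<kappa>) p (1, 0, 0, 0) = 0"
proof -
  have "\<forall>p\<in>gens_tilde \<kappa>. act (half_inv \<kappa>) p (1, 0, 0, 0) = 0"
    unfolding gens_tilde_def ball_simps
    by (simp_all add: act_simps power2_eq_square zero_prod_def)
  then show "p \<in> gens_tilde \<kappa> \<Longrightarrow> act (half_inv \<kappa>) p (1, 0, 0, 0) = 0" by blast
qed

lemma act_gens_E: "p \<in> gens_E \<kappa> \<Longrightarrow> act (half_inv \<kappa>) p (1, 0, 0, 0) = 0"
proof -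
  \<comment> \<open>An opaque name for \<open>\<i>\<close> keeps the simplifier from rearranging equations that contain \<open>\<i>\<close>.\<close>
  define j where "j = \<i>"
  have j: "j * j = - 1" "j * (j * x) = - x" for x
    by (simp_all add: j_def)
  have "\<forall>p\<in>gens_E \<kappa>. act (half_inv \<kappa>) p (1, 0, 0, 0) = 0"
    unfolding gens_E_def ball_simps A_el_def As_el_def vp_def vm_def j_def[symmetric]
    by (simp_all add: act_simps power2_eq_square zero_prod_def, simp_all add: j)
  then show "p \<in> gens_E \<kappa> \<Longrightarrow> act (half_inv \<kappa>) p (1, 0, 0, 0) = 0" by blast
qed

text \<open>Normal forms in the large algebra: combinations of \<open>1, a\<^sub>0 - 1, w\<^sub>0, w\<^sub>0\<^sup>*\<close>.\<close>
definition nf_tilde :: "vec \<Rightarrow> free_alg" where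
  "nf_tilde = (\<lambda>(x, y, z, u). scal x + scal y * (a0 - 1) + scal z * w0 + scal u * w0s)"

text \<open>Normal forms in the subalgebra: combinations of \<open>1, A - 1, v\<^sub>+, v\<^sub>-\<close>. These four elements
  send the cyclic vector to \<open>(1, 0, 0, 0)\<close>, \<open>(0, 2, 0, 0)\<close>, \<open>(0, -2 \<i> h, -\<i>, 0)\<close> and
  \<open>(0, 0, 0, \<i>)\<close>, which determines the coefficients of a given vector.\<close>
definition nf_E :: "real \<Rightarrow> vec \<Rightarrow> free_alg" where
  "nf_E \<kappa> = (\<lambda>(x, y, z, u). scal x + scal (y / 2 - half_inv \<kappa> * z) * (A_el - 1)
     + scal (\<i> * z) * vp - scal (\<i> * u) * vm)"

lemma nf_tilde_linear:
  "nf_tilde (v + w) = nf_tilde v + nf_tilde w" "nf_tilde (scl c v) = scal c * nf_tilde v"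
proof -
  obtain x y z u where v: "v = (x, y, z, u)" by (cases v)
  obtain x' y' z' u' where w: "w = (x', y', z', u')" by (cases w)
  show "nf_tilde (v + w) = nf_tilde v + nf_tilde w"
    unfolding v w nf_tilde_def add_Pair prod.case scal_simps(5) by (simp add: distrib_right)
  show "nf_tilde (scl c v) = scal c * nf_tilde v"
    unfolding v nf_tilde_def scl.simps prod.case scal_simps(7) distrib_left mult.assoc ..
qed

lemma nf_E_linear:
  "nf_E \<kappa> (v + w) = nf_E \<kappa> v + nf_E \<kappa> w" "nf_E \<kappa> (scl c v) = scal c * nf_E \<kappa> v"
proof -
  obtain x y z u where v: "v = (x, y, z, u)" by (cases v)
  obtain x' y' z' u' where w: "w = (x', y', z', u')" by (cases w)
  have *: "(y + y') / 2 - half_inv \<kappa> * (z + z') = (y / 2 - half_inv \<kappa> * z) + (y' / 2 - half_inv \<kappa> * z')"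
    "c * y / 2 - half_inv \<kappa> * (c * z) = c * (y / 2 - half_inv \<kappa> * z)"
    by (simp_all add: field_simps)
  have add: "scal ((y + y') / 2 - half_inv \<kappa> * (z + z')) = scal (y / 2 - half_inv \<kappa> * z) + scal (y' / 2 - half_inv \<kappa> * z')"
    "scal (\<i> * (z + z')) = scal (\<i> * z) + scal (\<i> * z')"
    "scal (\<i> * (u + u')) = scal (\<i> * u) + scal (\<i> * u')"
    unfolding *(1) distrib_left[of \<i>] by (rule scal_simps(5))+
  have scl: "scal (c * y / 2 - half_inv \<kappa> * (c * z)) = scal c * scal (y / 2 - half_inv \<kappa> * z)"
    "scal (\<i> * (c * z)) = scal c * scal (\<i> * z)" "scal (\<i> * (c * u)) = scal c * scal (\<i> * u)"
    unfolding *(2) mult.left_commute[of \<i> c] by (rule scal_simps(7))+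
  show "nf_E \<kappa> (v + w) = nf_E \<kappa> v + nf_E \<kappa> w"
    unfolding v w nf_E_def add_Pair prod.case add scal_simps(5)[of x x'] by (simp add: distrib_right)
  show "nf_E \<kappa> (scl c v) = scal c * nf_E \<kappa> v"
    unfolding v nf_E_def scl.simps prod.case scl scal_simps(7)[of c x]
      distrib_left right_diff_distrib mult.assoc ..
qed

section \<open>Reduction in the large algebra\<close>

locale reduction_tilde = reduction \<kappa> K UNIV nf_tilde for \<kappa> K +
  assumes gens: "gens_tilde \<kappa> \<subseteq> K"
begin

lemma reduces_gens: "reduces a0" "reduces w0" "reduces w0s"
proof -
  define H where "H = scal (half_inv \<kappa>)"
  have H: "x * H = H * x" "x * (H * y) = H * (x * y)" for x y
    unfolding H_def by (rule scal_left)+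
  define r1 where "r1 = a0 * a0s - 1"
  define r2 where "r2 = a0s * a0 - 1"
  define r3 where "r3 = a0 * w0 - w0 * a0 - H * (a0 * a0 - 1)"
  define r4 where "r4 = a0 * w0s - w0s * a0 + H * (a0 * a0 - 1)"
  define r5 where "r5 = w0 * w0s - w0s * w0 + H * ((a0 + a0s) * (w0 + w0s))"
  note r_defs = r1_def r2_def r3_def r4_def r5_def
  have r: "r1 \<in> rel_ideal \<kappa>" "r2 \<in> rel_ideal \<kappa>" "r3 \<in> rel_ideal \<kappa>"
    "r4 \<in> rel_ideal \<kappa>" "r5 \<in> rel_ideal \<kappa>"
    unfolding r_defs H_def by (rule relators_in_rel_ideal)+
  define g1 where "g1 = (a0 - 1) * (a0s - 1)"
  define g2 where "g2 = (a0 - 1) * w0s + H * (a0 - a0s)"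
  define g3 where "g3 = (a0 - 1) * w0 - H * (a0 - a0s)"
  define g6 where "g6 = w0s * w0 + H * (w0 - 3 * w0s) - H * H * (a0 - a0s)"
  define g7 where "g7 = w0\<^sup>2 + H * (w0s - 3 * w0) + H * H * (a0 - a0s)"
  define g8 where "g8 = w0s\<^sup>2 - H * (w0 - 3 * w0s) + H * H * (a0 - a0s)"
  note g_defs = g1_def g2_def g3_def g6_def g7_def g8_def
  have g: "g1 \<in> K" "g2 \<in> K" "g3 \<in> K" "g6 \<in> K" "g7 \<in> K" "g8 \<in> K"
    using gens unfolding gens_tilde_def g_defs H_def scal_simps by simp_all
  note K = K_add K_diff K_uminus K_scal K_mult[OF _ UNIV_I]
  have K_H: "H * p \<in> K" if "p \<in> K" for p
    unfolding H_def using that by (rule K_scal)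
  \<comment> \<open>\<open>f\<close> is \<open>(a\<^sub>0 - 1)\<^sup>2\<close> and \<open>d\<close> is \<open>2 - a\<^sub>0 - a\<^sub>0\<^sup>*\<close>, both rewritten to exhibit membership in \<open>K\<close>.\<close>
  define f where "f = - (g1 * a0) + (a0 - 1) * r2"
  define d where "d = g1 - r1"
  have fd: "f \<in> K" "d \<in> K"
    unfolding f_def d_def by (intro K g rel_K rel_closed r)+
  note norm = free_norm H[of "gen_el _"] H[of "scal _"] power2_eq_square
  have span: "\<exists>c1 c2 c3 c4. v = scl c1 (1, 0, 0, 0) + scl c2 (0, 1, 0, 0) + scl c3 (0, 0, 1, 0)
      + scl c4 (0, 0, 0, 1)" for v
    by (cases v) auto
  have e0: "nf_tilde (1, 0, 0, 0) * p - nf_tilde (act (half_inv \<kappa>) p (1, 0, 0, 0)) = 0"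
    if "p \<in> {a0, w0, w0s}" for p
    using that by (auto simp: nf_tilde_def act_simps scal_simps)
  note simps = nf_tilde_def act_simps scal_simps power2_eq_square H_def[symmetric]
  note defs = f_def d_def g_defs r_defs
  have "nf_tilde (0, 1, 0, 0) * a0 - nf_tilde (act (half_inv \<kappa>) a0 (0, 1, 0, 0)) = f"
    by (simp add: simps, unfold defs, simp add: norm)
  moreover have "nf_tilde (0, 0, 1, 0) * a0 - nf_tilde (act (half_inv \<kappa>) a0 (0, 0, 1, 0)) = g3 + H * d - H * f - r3"
    by (simp add: simps, unfold defs, simp add: norm)
  moreover have "nf_tilde (0, 0, 0, 1) * a0 - nf_tilde (act (half_inv \<kappa>) a0 (0, 0, 0, 1)) = g2 - H * d + H * f - r4"
    by (simp add: simps, unfold defs, simp add: norm)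
  ultimately show "reduces a0"
    by (intro reduces_spanI[OF span]) (simp_all add: e0 K K_H K_zero fd g rel_K r)
  have "nf_tilde (0, 1, 0, 0) * w0 - nf_tilde (act (half_inv \<kappa>) w0 (0, 1, 0, 0)) = g3 + H * d"
    by (simp add: simps, unfold defs, simp add: norm)
  moreover have "nf_tilde (0, 0, 1, 0) * w0 - nf_tilde (act (half_inv \<kappa>) w0 (0, 0, 1, 0)) = g7 - H * (H * d)"
    by (simp add: simps, unfold defs, simp add: norm)
  moreover have "nf_tilde (0, 0, 0, 1) * w0 - nf_tilde (act (half_inv \<kappa>) w0 (0, 0, 0, 1)) = g6 + H * (H * d)"
    by (simp add: simps, unfold defs, simp add: norm)
  ultimately show "reduces w0"
    by (intro reduces_spanI[OF span]) (simp_all add: e0 K K_H K_zero fd g rel_K r)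
  have "nf_tilde (0, 1, 0, 0) * w0s - nf_tilde (act (half_inv \<kappa>) w0s (0, 1, 0, 0)) = g2 - H * d"
    by (simp add: simps, unfold defs, simp add: norm)
  moreover have "nf_tilde (0, 0, 1, 0) * w0s - nf_tilde (act (half_inv \<kappa>) w0s (0, 0, 1, 0)) =
      g6 + H * (H * d) + r5 + H * (d * (w0 + w0s))"
    by (simp add: simps, unfold defs, simp add: norm)
  moreover have "nf_tilde (0, 0, 0, 1) * w0s - nf_tilde (act (half_inv \<kappa>) w0s (0, 0, 0, 1)) = g8 - H * (H * d)"
    by (simp add: simps, unfold defs, simp add: norm)
  ultimately show "reduces w0s"
    by (intro reduces_spanI[OF span]) (simp_all add: e0 K K_H K_zero fd g rel_K r)
qed

end

section \<open>Reduction in the subalgebra\<close>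

locale reduction_E = reduction \<kappa> K B "nf_E \<kappa>" for \<kappa> K B +
  assumes gens: "gens_E \<kappa> \<subseteq> K"
    and gens_B: "A_el \<in> B" "As_el \<in> B" "vp \<in> B" "vm \<in> B"
begin

lemma reduces_gens: "reduces A_el" "reduces As_el" "reduces vp" "reduces vm"
proof -
  define h where "h = half_inv \<kappa>"
  define H where "H = scal h"
  define N where "N = A_el - 1"
  have H: "x * H = H * x" "x * (H * y) = H * (x * y)" for x y
    unfolding H_def by (rule scal_left)+
  define r1 where "r1 = A_el * As_el - 1"
  define r2 where "r2 = As_el * A_el - 1"
  define rp where "rp = A_el * vp - vp * A_el - scal \<i> * (2 * H) * (A_el - A_el * A_el)"
  define rm where "rm = A_el * vm - vm * A_el - scal \<i> * (2 * H) * (1 - A_el)"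
  define rpm where "rpm = vp * vm - vm * vp - scal \<i> * (2 * H) * (vm - vp)"
  note r_defs = r1_def r2_def rp_def rm_def rpm_def
  have r: "r1 \<in> rel_ideal \<kappa>" "r2 \<in> rel_ideal \<kappa>" "rp \<in> rel_ideal \<kappa>"
    "rm \<in> rel_ideal \<kappa>" "rpm \<in> rel_ideal \<kappa>"
    unfolding r_defs H_def h_def by (rule E_relations)+
  define g1 where "g1 = (A_el - 1) * (As_el - 1)"
  define g2 where "g2 = (A_el - 1) * vm - scal \<i> * (2 * H) * (As_el - 1)"
  define g4 where "g4 = (A_el - 1) * vp + scal \<i> * (2 * H) * (A_el - 1)"
  define g6 where "g6 = vm * vp + scal \<i> * H * (vp + 3 * vm) + H * H * (As_el - A_el)"
  define g7 where "g7 = vp\<^sup>2 + scal \<i> * H * (3 * vp + vm) + H * H * (As_el - A_el)"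
  define g8 where "g8 = vm\<^sup>2 + scal \<i> * H * (vp + 3 * vm) + H * H * (As_el - A_el)"
  note g_defs = g1_def g2_def g4_def g6_def g7_def g8_def
  have g: "g1 \<in> K" "g2 \<in> K" "g4 \<in> K" "g6 \<in> K" "g7 \<in> K" "g8 \<in> K"
    using gens unfolding gens_E_def g_defs H_def h_def scal_simps by simp_all
  have K_H: "H * p \<in> K" if "p \<in> K" for p
    unfolding H_def using that by (rule K_scal)
  note K = K_add K_diff K_uminus K_scal K_H
  \<comment> \<open>\<open>f\<close> is \<open>(A - 1)\<^sup>2\<close> and \<open>d\<close> is \<open>2 - A - A\<^sup>*\<close>, both rewritten to exhibit membership in \<open>K\<close>.\<close>
  define f where "f = N * r2 - g1 * A_el"
  define d where "d = g1 - r1"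
  have fd: "f \<in> K" "d \<in> K"
    unfolding f_def d_def by (intro K K_mult[OF _ gens_B(1)] g rel_K rel_closed r)+
  note defs = f_def d_def g_defs r_defs N_def
  note norm = free_norm H[of "gen_el _"] H[of "scal _"] H[of A_el] H[of As_el] H[of vp] H[of vm]
    scal_left[of A_el] scal_left[of As_el] scal_left[of vp] scal_left[of vm] power2_eq_square

  \<comment> \<open>The images of the cyclic vector under \<open>1\<close>, \<open>A - 1\<close>, \<open>v\<^sub>+\<close> and \<open>v\<^sub>-\<close>; their normal forms are
    therefore these four elements themselves.\<close>
  define e1 where "e1 = ((1, 0, 0, 0) :: vec)"
  define e2 where "e2 = ((0, 2, 0, 0) :: vec)"
  define e3 where "e3 = ((0, - 2 * \<i> * h, - \<i>, 0) :: vec)"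
  define e4 where "e4 = ((0, 0, 0, \<i>) :: vec)"
  note e_defs = e1_def e2_def e3_def e4_def
  have span: "\<exists>c1 c2 c3 c4. v = scl c1 e1 + scl c2 e2 + scl c3 e3 + scl c4 e4" for v
  proof -
    obtain x y z u where v: "v = (x, y, z, u)" by (cases v)
    have "v = scl x e1 + scl (y / 2 - h * z) e2 + scl (\<i> * z) e3 + scl (- \<i> * u) e4"
      by (simp add: v e_defs algebra_simps)
    then show ?thesis by blast
  qed
  have nf: "nf_E \<kappa> e1 = 1" "nf_E \<kappa> e2 = N" "nf_E \<kappa> e3 = vp" "nf_E \<kappa> e4 = vm"
    by (simp_all add: nf_E_def e_defs N_def scal_simps h_def[symmetric] scal_i_square algebra_simps)
  have act_A: "act h A_el e1 = e1 + e2" "act h A_el e2 = e2" "act h A_el e3 = e3" "act h A_el e4 = e4"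
    by (simp_all add: e_defs A_el_def power2_eq_square act_simps)
  have act_vp: "act h vp e1 = e3" "act h vp e2 = - scl (\<i> * (2 * h)) e2"
    "act h vp e3 = scl (2 * h * h) e2 - scl (\<i> * h) (scl 3 e3 + e4)"
    "act h vp e4 = scl (2 * h * h) e2 - scl (\<i> * h) (e3 + scl 3 e4)"
    by (simp_all add: e_defs vp_def act_simps power2_eq_square mult.assoc
          mult.commute[of h \<i>] mult.left_commute[of h \<i>] mult.left_commute[of "numeral _" \<i>])
  have act_vm: "act h vm e1 = e4" "act h vm e2 = - scl (\<i> * (2 * h)) e2"
    "act h vm e3 = scl (2 * h * h) e2 - scl (\<i> * h) (scl 3 e3 + e4)"
    "act h vm e4 = scl (2 * h * h) e2 - scl (\<i> * h) (e3 + scl 3 e4)"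
    by (simp_all add: e_defs vm_def act_simps power2_eq_square mult.assoc
          mult.commute[of h \<i>] mult.left_commute[of h \<i>] mult.left_commute[of "numeral _" \<i>])

  have nf_diff: "nf_E \<kappa> (v - w) = nf_E \<kappa> v - nf_E \<kappa> w" for v w
    using nf_add[of v "- w"] by (simp add: nf_uminus)
  note nfs = nf_add nf_scl nf_uminus nf_diff nf
  have NA: "N * A_el - N = f"
    unfolding defs by (simp add: norm)
  have Np: "N * vp + scal (\<i> * (2 * h)) * N = g4"
    unfolding defs scal_simps H_def[symmetric] by (simp add: norm)
  have Nm: "N * vm + scal (\<i> * (2 * h)) * N = g2 - scal \<i> * (2 * H) * d"
    unfolding defs scal_simps H_def[symmetric] by (simp add: norm)
  show A: "reduces A_el"
  proof (rule reduces_spanI[OF span])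
    show "nf_E \<kappa> e1 * A_el - nf_E \<kappa> (act (half_inv \<kappa>) A_el e1) \<in> K"
      by (simp add: h_def[symmetric] act_A nfs N_def K_zero)
    show "nf_E \<kappa> e2 * A_el - nf_E \<kappa> (act (half_inv \<kappa>) A_el e2) \<in> K"
      by (simp add: h_def[symmetric] act_A nfs NA fd)
    have "vp * A_el - vp = g4 + scal \<i> * (H * f) + scal \<i> * (H * f) - rp"
      unfolding defs by (simp add: norm)
    then show "nf_E \<kappa> e3 * A_el - nf_E \<kappa> (act (half_inv \<kappa>) A_el e3) \<in> K"
      by (simp add: h_def[symmetric] act_A nfs K fd g rel_K r)
    have "vm * A_el - vm = g2 - scal \<i> * (H * d) - scal \<i> * (H * d) - rm"
      unfolding defs by (simp add: norm)
    then show "nf_E \<kappa> e4 * A_el - nf_E \<kappa> (act (half_inv \<kappa>) A_el e4) \<in> K"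
      by (simp add: h_def[symmetric] act_A nfs K fd g rel_K r)
  qed
  show "reduces As_el"
    using A gens_B(2) E_relations(1,2) by (rule reduces_inverse)
  show "reduces vp"
  proof (rule reduces_spanI[OF span])
    show "nf_E \<kappa> e1 * vp - nf_E \<kappa> (act (half_inv \<kappa>) vp e1) \<in> K"
      by (simp add: h_def[symmetric] act_vp nfs K_zero)
    show "nf_E \<kappa> e2 * vp - nf_E \<kappa> (act (half_inv \<kappa>) vp e2) \<in> K"
      by (simp add: h_def[symmetric] act_vp nfs Np g)
    have "vp * vp - (scal (2 * h * h) * N - scal (\<i> * h) * (scal 3 * vp + vm)) = g7 + H * (H * d)"
      unfolding scal_simps H_def[symmetric] defs by (simp add: norm)
    then show "nf_E \<kappa> e3 * vp - nf_E \<kappa> (act (half_inv \<kappa>) vp e3) \<in> K"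
      by (simp only: h_def[symmetric] act_vp nfs) (simp add: K fd g rel_K r)
    have "vm * vp - (scal (2 * h * h) * N - scal (\<i> * h) * (vp + scal 3 * vm)) = g6 + H * (H * d)"
      unfolding scal_simps H_def[symmetric] defs by (simp add: norm)
    then show "nf_E \<kappa> e4 * vp - nf_E \<kappa> (act (half_inv \<kappa>) vp e4) \<in> K"
      by (simp only: h_def[symmetric] act_vp nfs) (simp add: K fd g rel_K r)
  qed
  show "reduces vm"
  proof (rule reduces_spanI[OF span])
    show "nf_E \<kappa> e1 * vm - nf_E \<kappa> (act (half_inv \<kappa>) vm e1) \<in> K"
      by (simp add: h_def[symmetric] act_vm nfs K_zero)
    have "g2 - scal \<i> * (2 * H) * d \<in> K"
      by (simp add: norm K g fd)
    then show "nf_E \<kappa> e2 * vm - nf_E \<kappa> (act (half_inv \<kappa>) vm e2) \<in> K"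
      by (simp add: h_def[symmetric] act_vm nfs Nm)
    have "vp * vm - (scal (2 * h * h) * N - scal (\<i> * h) * (scal 3 * vp + vm))
        = g6 + H * (H * d) + rpm"
      unfolding scal_simps H_def[symmetric] defs by (simp add: norm)
    then show "nf_E \<kappa> e3 * vm - nf_E \<kappa> (act (half_inv \<kappa>) vm e3) \<in> K"
      by (simp only: h_def[symmetric] act_vm nfs) (simp add: K fd g rel_K r)
    have "vm * vm - (scal (2 * h * h) * N - scal (\<i> * h) * (vp + scal 3 * vm)) = g8 + H * (H * d)"
      unfolding scal_simps H_def[symmetric] defs by (simp add: norm)
    then show "nf_E \<kappa> e4 * vm - nf_E \<kappa> (act (half_inv \<kappa>) vm e4) \<in> K"
      by (simp only: h_def[symmetric] act_vm nfs) (simp add: K fd g rel_K r)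
  qed
qed

end

section \<open>Generated right ideals and cosets\<close>

text \<open>Closure under negation need not be assumed, as it is right multiplication by \<open>-1\<close>.\<close>
lemma right_idealI:
  assumes "ring R" "I \<subseteq> carrier R" "\<zero>\<^bsub>R\<^esub> \<in> I"
    and add: "\<And>a b. a \<in> I \<Longrightarrow> b \<in> I \<Longrightarrow> a \<oplus>\<^bsub>R\<^esub> b \<in> I"
    and mult: "\<And>a x. a \<in> I \<Longrightarrow> x \<in> carrier R \<Longrightarrow> a \<otimes>\<^bsub>R\<^esub> x \<in> I"
  shows "right_ideal I R"
proof -
  interpret ring R by fact
  have "\<ominus>\<^bsub>R\<^esub> a \<in> I" if "a \<in> I" for a
  proof -
    have "\<ominus>\<^bsub>R\<^esub> a = a \<otimes>\<^bsub>R\<^esub> \<ominus>\<^bsub>R\<^esub> \<one>\<^bsub>R\<^esub>"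
      using that assms(2) by (simp add: r_minus subset_iff)
    then show ?thesis using mult[OF that, of "\<ominus>\<^bsub>R\<^esub> \<one>\<^bsub>R\<^esub>"] by simp
  qed
  then have "subgroup I (add_monoid R)"
    using assms by (intro add.subgroupI) auto
  then show ?thesis
    by (intro right_ideal.intro additive_subgroup.intro right_ideal_axioms.intro assms(1) mult)
qed

lemma gen_right_ideal_closed:
  "\<zero>\<^bsub>R\<^esub> \<in> gen_right_ideal R S"
  "a \<in> gen_right_ideal R S \<Longrightarrow> b \<in> gen_right_ideal R S \<Longrightarrow> a \<oplus>\<^bsub>R\<^esub> b \<in> gen_right_ideal R S"
  "a \<in> gen_right_ideal R S \<Longrightarrow> x \<in> carrier R \<Longrightarrow> a \<otimes>\<^bsub>R\<^esub> x \<in> gen_right_ideal R S"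
  unfolding gen_right_ideal_def
  by (auto simp: right_ideal_def right_ideal_axioms_def additive_subgroup.zero_closed
        additive_subgroup.a_closed)

lemma gen_right_ideal_superset: "S \<subseteq> gen_right_ideal R S"
  unfolding gen_right_ideal_def by auto

lemma gen_right_ideal_minimal: "right_ideal I R \<Longrightarrow> S \<subseteq> I \<Longrightarrow> gen_right_ideal R S \<subseteq> I"
  unfolding gen_right_ideal_def by auto

lemma carrier_E_tilde: "carrier (E_tilde \<kappa>) = range (cls \<kappa>)"
  by (auto simp: E_tilde_def FactRing_def A_RCOSETS_defs cls_def a_r_coset_def)

lemma cls_eq_iff: "cls \<kappa> p = cls \<kappa> q \<longleftrightarrow> p - q \<in> rel_ideal \<kappa>"
proof -
  have "p \<ominus>\<^bsub>Free\<^esub> q = p - q"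
    by (simp add: a_minus_def a_inv_Free)
  then show ?thesis
    using ring.quotient_eq_iff_same_a_r_cos[OF ring_Free ideal_rel_ideal[of \<kappa>], of p q]
    by (simp add: cls_def)
qed

lemma cls_simps:
  "cls \<kappa> p \<oplus>\<^bsub>E_tilde \<kappa>\<^esub> cls \<kappa> q = cls \<kappa> (p + q)"
  "cls \<kappa> p \<otimes>\<^bsub>E_tilde \<kappa>\<^esub> cls \<kappa> q = cls \<kappa> (p * q)"
  "\<one>\<^bsub>E_tilde \<kappa>\<^esub> = cls \<kappa> 1"
  "\<zero>\<^bsub>E_tilde \<kappa>\<^esub> = cls \<kappa> 0"
  "\<ominus>\<^bsub>E_tilde \<kappa>\<^esub> cls \<kappa> p = cls \<kappa> (- p)"
proof -
  interpret ring_hom_ring Free "E_tilde \<kappa>" "cls \<kappa>"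
    by (rule ring_hom_ringI2[OF ring_Free ring_E_tilde cls_hom])
  show "cls \<kappa> p \<oplus>\<^bsub>E_tilde \<kappa>\<^esub> cls \<kappa> q = cls \<kappa> (p + q)"
    "cls \<kappa> p \<otimes>\<^bsub>E_tilde \<kappa>\<^esub> cls \<kappa> q = cls \<kappa> (p * q)"
    "\<one>\<^bsub>E_tilde \<kappa>\<^esub> = cls \<kappa> 1"
    "\<zero>\<^bsub>E_tilde \<kappa>\<^esub> = cls \<kappa> 0"
    "\<ominus>\<^bsub>E_tilde \<kappa>\<^esub> cls \<kappa> p = cls \<kappa> (- p)"
    using hom_add[of p q] hom_mult[of p q] hom_one hom_zero hom_a_inv[of p]
    by (simp_all add: a_inv_Free)
qed

section \<open>The right ideal of the large algebra is an annihilator\<close>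

lemma R0_tilde_annihilates:
  assumes "cls \<kappa> p \<in> R0_tilde \<kappa>"
  shows "act (half_inv \<kappa>) p (1, 0, 0, 0) = 0"
proof -
  let ?I = "cls \<kappa> ` {p. act (half_inv \<kappa>) p (1, 0, 0, 0) = 0}"
  have "right_ideal ?I (E_tilde \<kappa>)"
  proof (rule right_idealI[OF ring_E_tilde])
    show "\<zero>\<^bsub>E_tilde \<kappa>\<^esub> \<in> ?I"
      unfolding cls_simps by (rule imageI) simp
    show "a \<oplus>\<^bsub>E_tilde \<kappa>\<^esub> b \<in> ?I" if ab: "a \<in> ?I" "b \<in> ?I" for a b
    proof -
      obtain p q where "a = cls \<kappa> p" "b = cls \<kappa> q"
        "act (half_inv \<kappa>) p (1, 0, 0, 0) = 0" "act (half_inv \<kappa>) q (1, 0, 0, 0) = 0"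
        using ab by auto
      then show ?thesis by (simp add: cls_simps act_add)
    qed
    show "a \<otimes>\<^bsub>E_tilde \<kappa>\<^esub> x \<in> ?I" if ax: "a \<in> ?I" "x \<in> carrier (E_tilde \<kappa>)" for a x
    proof -
      obtain p q where "a = cls \<kappa> p" "x = cls \<kappa> q" "act (half_inv \<kappa>) p (1, 0, 0, 0) = 0"
        using ax by (auto simp: carrier_E_tilde)
      then show ?thesis by (simp add: cls_simps act_mult act_0_right)
    qed
  qed (auto simp: carrier_E_tilde)
  moreover have "cls \<kappa> ` gens_tilde \<kappa> \<subseteq> ?I"
    using act_gens_tilde by blast
  ultimately have "R0_tilde \<kappa> \<subseteq> ?I"
    unfolding R0_tilde_eq_gens by (rule gen_right_ideal_minimal)
  then obtain q where q: "cls \<kappa> p = cls \<kappa> q" "act (half_inv \<kappa>) q (1, 0, 0, 0) = 0"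
    using assms by auto
  then show ?thesis
    using act_rel_ideal[of "p - q" \<kappa> "(1, 0, 0, 0)"] by (simp add: cls_eq_iff act_diff)
qed

lemma free_alg_induct [case_names scal gen add mult]:
  assumes scal: "\<And>c. P (scal c)" and gen: "\<And>g. P (gen_el g)"
    and add: "\<And>p q. P p \<Longrightarrow> P q \<Longrightarrow> P (p + q)" and mult: "\<And>p q. P p \<Longrightarrow> P q \<Longrightarrow> P (p * q)"
  shows "P p"
proof -
  have word: "P (Poly_Mapping.single (Word l) 1)" for l
  proof (induction l)
    case Nil
    show ?case using scal[of 1] by (simp add: scal_def zero_word_def)
  next
    case (Cons g l)
    have "Poly_Mapping.single (Word (g # l)) 1 = gen_el g * Poly_Mapping.single (Word l) 1"
      by (simp add: gen_el_def mult_single plus_word_def)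
    then show ?case using mult[OF gen Cons] by simp
  qed
  have single: "P (Poly_Mapping.single w c)" for w c
  proof -
    have "Poly_Mapping.single w c = scal c * Poly_Mapping.single w 1"
      by (simp add: scal_def mult_single)
    then show ?thesis using mult[OF scal word[of "letters w"]] by simp
  qed
  have zero: "P 0"
    using scal[of 0] by (simp add: scal_simps)
  have "P (\<Sum>w\<in>S. Poly_Mapping.single w (Poly_Mapping.lookup p w))" for S
    by (induction S rule: infinite_finite_induct) (auto intro: zero add single)
  from this[of "Poly_Mapping.keys p"] show ?thesis
    by (simp only: poly_mapping_sum_single)
qed

lemma reduction_R0_tilde: "reduction_tilde \<kappa> {p. cls \<kappa> p \<in> R0_tilde \<kappa>}"
proof unfold_locales
  note closed = gen_right_ideal_closed[where R = "E_tilde \<kappa>" and S = "cls \<kappa> ` gens_tilde \<kappa>",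
      folded R0_tilde_eq_gens, unfolded carrier_E_tilde]
  show zero: "0 \<in> {p. cls \<kappa> p \<in> R0_tilde \<kappa>}"
    using closed(1) by (simp add: cls_simps)
  show "p + q \<in> {p. cls \<kappa> p \<in> R0_tilde \<kappa>}"
    if "p \<in> {p. cls \<kappa> p \<in> R0_tilde \<kappa>}" "q \<in> {p. cls \<kappa> p \<in> R0_tilde \<kappa>}" for p q
    using closed(2)[of "cls \<kappa> p" "cls \<kappa> q"] that by (simp add: cls_simps)
  show mult: "p * q \<in> {p. cls \<kappa> p \<in> R0_tilde \<kappa>}" if "p \<in> {p. cls \<kappa> p \<in> R0_tilde \<kappa>}" for p q
    using closed(3)[of "cls \<kappa> p" "cls \<kappa> q"] that by (simp add: cls_simps)
  show "- p \<in> {p. cls \<kappa> p \<in> R0_tilde \<kappa>}" if "p \<in> {p. cls \<kappa> p \<in> R0_tilde \<kappa>}" for p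
    using mult[OF that, of "- 1"] by simp
  show "p \<in> {p. cls \<kappa> p \<in> R0_tilde \<kappa>}" if "p \<in> rel_ideal \<kappa>" for p
    using zero that cls_eq_iff[of \<kappa> p 0] by simp
  show "gens_tilde \<kappa> \<subseteq> {p. cls \<kappa> p \<in> R0_tilde \<kappa>}"
    using gen_right_ideal_superset[where R = "E_tilde \<kappa>" and S = "cls \<kappa> ` gens_tilde \<kappa>"]
    unfolding R0_tilde_eq_gens by blast
  show "nf_tilde (1, 0, 0, 0) = 1"
    by (simp add: nf_tilde_def scal_simps)
qed (simp_all only: UNIV_I nf_tilde_linear)

lemma R0_tilde_iff: "cls \<kappa> p \<in> R0_tilde \<kappa> \<longleftrightarrow> act (half_inv \<kappa>) p (1, 0, 0, 0) = 0"
proof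
  interpret reduction_tilde \<kappa> "{p. cls \<kappa> p \<in> R0_tilde \<kappa>}"
    by (rule reduction_R0_tilde)
  have "reduces p"
  proof (induction p rule: free_alg_induct)
    case (gen g)
    have "reduces a0s"
      by (rule reduces_inverse[OF reduces_gens(1) _ relators_in_rel_ideal(1,2)]) simp
    then show ?case using reduces_gens by (cases g) auto
  qed (auto intro: reduces_scal reduces_add reduces_mult)
  then show "act (half_inv \<kappa>) p (1, 0, 0, 0) = 0 \<Longrightarrow> cls \<kappa> p \<in> R0_tilde \<kappa>"
    using reduces_memI by blast
qed (rule R0_tilde_annihilates)

section \<open>The right ideal of the subalgebra\<close>

lemma E_alg_simps [simp]:
  "carrier (E_alg \<kappa>) = E_carrier \<kappa>"
  "monoid.mult (E_alg \<kappa>) = monoid.mult (E_tilde \<kappa>)"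
  "ring.add (E_alg \<kappa>) = ring.add (E_tilde \<kappa>)"
  "ring.zero (E_alg \<kappa>) = ring.zero (E_tilde \<kappa>)"
  by (simp_all add: E_alg_def)

lemma cls_in_E_carrier:
  "cls \<kappa> p \<in> E_carrier \<kappa> \<Longrightarrow> cls \<kappa> q \<in> E_carrier \<kappa> \<Longrightarrow> cls \<kappa> (p + q) \<in> E_carrier \<kappa>"
  "cls \<kappa> p \<in> E_carrier \<kappa> \<Longrightarrow> cls \<kappa> q \<in> E_carrier \<kappa> \<Longrightarrow> cls \<kappa> (p * q) \<in> E_carrier \<kappa>"
  "cls \<kappa> p \<in> E_carrier \<kappa> \<Longrightarrow> cls \<kappa> q \<in> E_carrier \<kappa> \<Longrightarrow> cls \<kappa> (p - q) \<in> E_carrier \<kappa>"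
  "cls \<kappa> (scal c) \<in> E_carrier \<kappa>" "cls \<kappa> 1 \<in> E_carrier \<kappa>" "cls \<kappa> (numeral n) \<in> E_carrier \<kappa>"
  "cls \<kappa> A_el \<in> E_carrier \<kappa>" "cls \<kappa> As_el \<in> E_carrier \<kappa>"
  "cls \<kappa> vp \<in> E_carrier \<kappa>" "cls \<kappa> vm \<in> E_carrier \<kappa>"
proof -
  have add: "cls \<kappa> (p + q) \<in> E_carrier \<kappa>"
    if "cls \<kappa> p \<in> E_carrier \<kappa>" "cls \<kappa> q \<in> E_carrier \<kappa>" for p q
    using generate_ring.eng_add[OF that[unfolded E_carrier_def]] by (simp add: cls_simps E_carrier_def)
  then show "cls \<kappa> p \<in> E_carrier \<kappa> \<Longrightarrow> cls \<kappa> q \<in> E_carrier \<kappa> \<Longrightarrow> cls \<kappa> (p + q) \<in> E_carrier \<kappa>" .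
  show "cls \<kappa> (p * q) \<in> E_carrier \<kappa>" if "cls \<kappa> p \<in> E_carrier \<kappa>" "cls \<kappa> q \<in> E_carrier \<kappa>"
    using generate_ring.eng_mult[OF that[unfolded E_carrier_def]] by (simp add: cls_simps E_carrier_def)
  show "cls \<kappa> (p - q) \<in> E_carrier \<kappa>" if "cls \<kappa> p \<in> E_carrier \<kappa>" "cls \<kappa> q \<in> E_carrier \<kappa>"
    using add[OF that(1), of "- q"] generate_ring.a_inv[OF that(2)[unfolded E_carrier_def]]
    by (simp add: cls_simps E_carrier_def)
  show scal: "cls \<kappa> (scal c) \<in> E_carrier \<kappa>" for c
    unfolding E_carrier_def by (rule generate_ring.incl) simp
  show "cls \<kappa> 1 \<in> E_carrier \<kappa>" "cls \<kappa> (numeral n) \<in> E_carrier \<kappa>"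
    using scal[of 1] scal[of "numeral n"] by (simp_all add: scal_simps)
  show "cls \<kappa> A_el \<in> E_carrier \<kappa>" "cls \<kappa> As_el \<in> E_carrier \<kappa>"
    "cls \<kappa> vp \<in> E_carrier \<kappa>" "cls \<kappa> vm \<in> E_carrier \<kappa>"
    unfolding E_carrier_def by (rule generate_ring.incl, simp)+
qed

lemma gens_E_in_E_carrier: "cls \<kappa> ` gens_E \<kappa> \<subseteq> E_carrier \<kappa>"
  unfolding gens_E_def power2_eq_square by (simp add: cls_in_E_carrier)

lemma reduction_R0:
  "reduction_E \<kappa> {p. cls \<kappa> p \<in> gen_right_ideal (E_alg \<kappa>) (cls \<kappa> ` gens_E \<kappa>)}
     {p. cls \<kappa> p \<in> E_carrier \<kappa>}" (is "reduction_E \<kappa> ?K ?B")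
proof unfold_locales
  note closed = gen_right_ideal_closed[where R = "E_alg \<kappa>" and S = "cls \<kappa> ` gens_E \<kappa>", unfolded E_alg_simps]
  show zero: "0 \<in> ?K"
    using closed(1) by (simp add: cls_simps)
  show "p + q \<in> ?K" if "p \<in> ?K" "q \<in> ?K" for p q
    using closed(2)[of "cls \<kappa> p" "cls \<kappa> q"] that by (simp add: cls_simps)
  show mult: "p * q \<in> ?K" if "p \<in> ?K" "q \<in> ?B" for p q
    using closed(3)[of "cls \<kappa> p" "cls \<kappa> q"] that by (simp add: cls_simps)
  show scal: "scal c \<in> ?B" for c
    by (simp add: cls_in_E_carrier)
  show "- p \<in> ?K" if "p \<in> ?K" for p
    using mult[OF that scal[of "- 1"]] by (simp add: scal_simps)
  show "p \<in> ?K" if "p \<in> rel_ideal \<kappa>" for p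
    using zero that cls_eq_iff[of \<kappa> p 0] by simp
  show "gens_E \<kappa> \<subseteq> ?K"
    using gen_right_ideal_superset[where R = "E_alg \<kappa>" and S = "cls \<kappa> ` gens_E \<kappa>"] by blast
  show "nf_E \<kappa> (1, 0, 0, 0) = 1"
    by (simp add: nf_E_def scal_simps)
qed (simp_all add: nf_E_linear cls_in_E_carrier)

theorem corollary1:
  fixes \<kappa> :: real
  assumes "\<kappa> \<noteq> 0"
  shows "carrier (E_alg \<kappa>) \<inter> R0_tilde \<kappa> = gen_right_ideal (E_alg \<kappa>) (cls \<kappa> `
    {(A_el - 1) * (As_el - 1),
     (A_el - 1) * vm - scal (\<i> / \<kappa>) * (As_el - 1),
     (As_el - 1) * vm + scal (\<i> / \<kappa>) * (As_el - 1),
     (A_el - 1) * vp + scal (\<i> / \<kappa>) * (A_el - 1),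
     (As_el - 1) * vp - scal (\<i> / \<kappa>) * (A_el - 1),
     vm * vp + scal (\<i> / (2 * \<kappa>)) * (vp + 3 * vm) + scal (1 / (4 * \<kappa>\<^sup>2)) * (As_el - A_el),
     vp\<^sup>2 + scal (\<i> / (2 * \<kappa>)) * (3 * vp + vm) + scal (1 / (4 * \<kappa>\<^sup>2)) * (As_el - A_el),
     vm\<^sup>2 + scal (\<i> / (2 * \<kappa>)) * (vp + 3 * vm) + scal (1 / (4 * \<kappa>\<^sup>2)) * (As_el - A_el)})"
  unfolding coeffs_half_inv unfolding i_over_eq_half_inv gens_E_def[symmetric]
proof (rule subset_antisym)
  interpret reduction_E \<kappa> "{p. cls \<kappa> p \<in> gen_right_ideal (E_alg \<kappa>) (cls \<kappa> ` gens_E \<kappa>)}"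
    "{p. cls \<kappa> p \<in> E_carrier \<kappa>}"
    by (rule reduction_R0)
  \<comment> \<open>The elements of the subalgebra are only given as classes, so the reduction is proved for some
    representative.\<close>
  have reduces_E: "\<exists>p. x = cls \<kappa> p \<and> reduces p" if "x \<in> E_carrier \<kappa>" for x
    using that unfolding E_carrier_def
  proof (induction rule: generate_ring.induct)
    case one
    show ?case using reduces_one by (auto simp: cls_simps)
  next
    case (incl h)
    then show ?case using reduces_scal reduces_gens by auto
  next
    case (a_inv h)
    then show ?case using reduces_uminus by (auto simp: cls_simps)
  next
    case (eng_add h1 h2)
    then show ?case using reduces_add by (metis cls_simps(1))
  next
    case (eng_mult h1 h2)
    then obtain p q where "h1 = cls \<kappa> p" "reduces p" "h2 = cls \<kappa> q" "reduces q"
      by blast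
    moreover have "reduces (p * q)"
      using eng_mult(2) calculation by (intro reduces_mult) (auto simp: E_carrier_def)
    ultimately show ?case by (auto simp: cls_simps)
  qed
  show "carrier (E_alg \<kappa>) \<inter> R0_tilde \<kappa> \<subseteq> gen_right_ideal (E_alg \<kappa>) (cls \<kappa> ` gens_E \<kappa>)"
  proof
    fix x assume x: "x \<in> carrier (E_alg \<kappa>) \<inter> R0_tilde \<kappa>"
    then obtain p where p: "x = cls \<kappa> p" "reduces p"
      using reduces_E by auto
    with x have "act (half_inv \<kappa>) p (1, 0, 0, 0) = 0"
      by (simp add: R0_tilde_iff)
    with p show "x \<in> gen_right_ideal (E_alg \<kappa>) (cls \<kappa> ` gens_E \<kappa>)"
      using reduces_memI by blast
  qed
next
  have E_sub: "E_carrier \<kappa> \<subseteq> carrier (E_tilde \<kappa>)"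
    unfolding E_carrier_def by (rule ring.generate_ring_incl[OF ring_E_tilde E_gens_in_carrier])
  note closed = gen_right_ideal_closed[where R = "E_tilde \<kappa>" and S = "cls \<kappa> ` gens_tilde \<kappa>", folded R0_tilde_eq_gens]
  interpret E: ring "E_alg \<kappa>" by (rule ring_E)
  have "right_ideal (E_carrier \<kappa> \<inter> R0_tilde \<kappa>) (E_alg \<kappa>)"
    using E.zero_closed E.add.m_closed E.m_closed E_sub closed
    by (intro right_idealI[OF ring_E]) auto
  moreover have "cls \<kappa> ` gens_E \<kappa> \<subseteq> E_carrier \<kappa> \<inter> R0_tilde \<kappa>"
    using gens_E_in_E_carrier[of \<kappa>] act_gens_E by (auto simp: R0_tilde_iff)
  ultimately show "gen_right_ideal (E_alg \<kappa>) (cls \<kappa> ` gens_E \<kappa>) \<subseteq> carrier (E_alg \<kappa>) \<inter> R0_tilde \<kappa>"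
    unfolding E_alg_simps by (rule gen_right_ideal_minimal)
qed

end
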